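(* Admissible sign patterns are closed under negation and the action of the hyperoctahedral group $\mathfrak{B}_N$: if $s$ is an admissible sign pattern on a finite set $N$, then $-s$ is admissible and $g \cdot s$ is admissible for every $g \in \mathfrak{B}_N$.
   Context: A sign pattern on a finite set $N$ is a function $s: 2^N \to \{+,-\}$; signs are multiplied as elements of $\{\pm1\}$. It is admissible if $s(\emptyset) = +$ and, for all $i \neq j$ in $N$ and all $K \subseteq N \setminus \{i,j\}$, the implication $[s(K\cup\{i\}) \neq s(K \cup\{j\})] \implies [s(K) \neq s(K\cup\{i,j\})]$ holds. The negative of $s$ is $(-s)(K) = (-1)^{|K|} s(K)$. The hyperoctahedral group $\mathfrak{B}_N = (\mathbb{Z}/2)^N \rtimes \mathfrak{S}_N$ acts on sign patterns; every element is a product of a swap and a permutation. A permutation $\pi \in \mathfrak{S}_N$ acts by $(\pi\cdot s)(K) = s(\pi(K))$. The swap of a subset $Z \subseteq N$ (elements of $(\mathbb{Z}/2)^N$ are identified with subsets of $N$) acts by $(Z\cdot s)(K) = (-1)^{|Z\cap K|}\, s(Z)\, s(Z \oplus K)$, where $\oplus$ is symmetric difference. *)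

theory Defs
  imports "HOL-Algebra.Group" "HOL-Combinatorics.Permutations" "HOL-Library.FuncSet"
begin

(* Signs are the integers 1 and -1, and a sign pattern is an extensional function on Pow N,
   so that equality of sign patterns on N is equality in HOL. *)
definition sign_patterns :: "'a set \<Rightarrow> ('a set \<Rightarrow> int) set" where
  "sign_patterns N = Pow N \<rightarrow>\<^sub>E {1, -1}"

definition admissible :: "'a set \<Rightarrow> ('a set \<Rightarrow> int) \<Rightarrow> bool" where
  "admissible N s \<longleftrightarrow>
     s \<in> sign_patterns N \<and> s {} = 1 \<and>
     (\<forall>i\<in>N. \<forall>j\<in>N. i \<noteq> j \<longrightarrow>
       (\<forall>K. K \<subseteq> N - {i, j} \<longrightarrow>
         s (K \<union> {i}) \<noteq> s (K \<union> {j}) \<longrightarrow> s K \<noteq> s (K \<union> {i, j})))"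

definition negative :: "'a set \<Rightarrow> ('a set \<Rightarrow> int) \<Rightarrow> 'a set \<Rightarrow> int" where
  "negative N s = (\<lambda>K\<in>Pow N. (-1) ^ card K * s K)"

definition permute :: "'a set \<Rightarrow> ('a \<Rightarrow> 'a) \<Rightarrow> ('a set \<Rightarrow> int) \<Rightarrow> 'a set \<Rightarrow> int" where
  "permute N \<pi> s = (\<lambda>K\<in>Pow N. s (\<pi> ` K))"

definition swap :: "'a set \<Rightarrow> 'a set \<Rightarrow> ('a set \<Rightarrow> int) \<Rightarrow> 'a set \<Rightarrow> int" where
  "swap N Z s = (\<lambda>K\<in>Pow N. (-1) ^ card (Z \<inter> K) * s Z * s (sym_diff Z K))"

(* The semidirect product of (Z/2)^N and the symmetric group of N. The group (Z/2)^N is Pow N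
   under symmetric difference, and (Z, p) stands for the product of the swap of Z and the
   permutation p. Since (p . s)(K) = s(p(K)) gives p . (q . s) = (q o p) . s, permutations are
   multiplied from left to right; with this product, the operation on sign patterns given by
   the formulas above is a left action, see hyperoctahedral_action_mult below. *)
definition hyperoctahedral_group :: "'a set \<Rightarrow> ('a set \<times> ('a \<Rightarrow> 'a)) monoid" where
  "hyperoctahedral_group N =
     \<lparr>carrier = Pow N \<times> {\<pi>. \<pi> permutes N},
      monoid.mult = (\<lambda>(Z, \<pi>) (W, \<sigma>). (sym_diff Z (\<pi> -` W), \<sigma> \<circ> \<pi>)),
      one = ({}, id)\<rparr>"

definition hyperoctahedral_action ::
  "'a set \<Rightarrow> 'a set \<times> ('a \<Rightarrow> 'a) \<Rightarrow> ('a set \<Rightarrow> int) \<Rightarrow> 'a set \<Rightarrow> int" where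
  "hyperoctahedral_action N g s = (case g of (Z, \<pi>) \<Rightarrow> swap N Z (permute N \<pi> s))"

lemma permutes_vimage_subset: "\<pi> permutes N \<Longrightarrow> W \<subseteq> N \<Longrightarrow> \<pi> -` W \<subseteq> N"
  using permutes_in_image by fastforce

lemma group_hyperoctahedral_group: "group (hyperoctahedral_group N)"
proof (rule groupI)
  fix x assume "x \<in> carrier (hyperoctahedral_group N)"
  then obtain Z \<pi> where x: "x = (Z, \<pi>)" "Z \<subseteq> N" "\<pi> permutes N"
    by (auto simp: hyperoctahedral_group_def)
  have "(inv_into UNIV \<pi> -` Z, inv_into UNIV \<pi>) \<in> carrier (hyperoctahedral_group N)"
    using x permutes_vimage_subset[OF permutes_inv[OF x(3)] x(2)] permutes_inv[OF x(3)]
    by (auto simp: hyperoctahedral_group_def)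
  moreover have "(inv_into UNIV \<pi> -` Z, inv_into UNIV \<pi>) \<otimes>\<^bsub>hyperoctahedral_group N\<^esub> x = \<one>\<^bsub>hyperoctahedral_group N\<^esub>"
    using x by (auto simp: hyperoctahedral_group_def permutes_inv_o)
  ultimately show "\<exists>y\<in>carrier (hyperoctahedral_group N).
      y \<otimes>\<^bsub>hyperoctahedral_group N\<^esub> x = \<one>\<^bsub>hyperoctahedral_group N\<^esub>"
    by blast
next
  fix x y assume "x \<in> carrier (hyperoctahedral_group N)" "y \<in> carrier (hyperoctahedral_group N)"
  then obtain Z \<pi> W \<sigma> where xy: "x = (Z, \<pi>)" "y = (W, \<sigma>)"
    and *: "Z \<subseteq> N" "\<pi> permutes N" "W \<subseteq> N" "\<sigma> permutes N"
    by (auto simp: hyperoctahedral_group_def)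
  have "sym_diff Z (\<pi> -` W) \<subseteq> N"
    using *(1) permutes_vimage_subset[OF *(2,3)] by blast
  then show "x \<otimes>\<^bsub>hyperoctahedral_group N\<^esub> y \<in> carrier (hyperoctahedral_group N)"
    using permutes_compose[OF *(2,4)] by (simp add: xy hyperoctahedral_group_def)
next
  fix x y z :: "'a set \<times> ('a \<Rightarrow> 'a)"
  obtain Z \<pi> W \<sigma> V \<tau> where xyz: "x = (Z, \<pi>)" "y = (W, \<sigma>)" "z = (V, \<tau>)"
    by (metis surj_pair)
  have "sym_diff (sym_diff Z (\<pi> -` W)) ((\<sigma> \<circ> \<pi>) -` V) = sym_diff Z (\<pi> -` sym_diff W (\<sigma> -` V))"
    by auto
  then show "x \<otimes>\<^bsub>hyperoctahedral_group N\<^esub> y \<otimes>\<^bsub>hyperoctahedral_group N\<^esub> z =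
      x \<otimes>\<^bsub>hyperoctahedral_group N\<^esub> (y \<otimes>\<^bsub>hyperoctahedral_group N\<^esub> z)"
    unfolding xyz hyperoctahedral_group_def monoid.simps prod.case by (simp only: o_assoc)
next
  show "\<one>\<^bsub>hyperoctahedral_group N\<^esub> \<in> carrier (hyperoctahedral_group N)"
    by (simp add: hyperoctahedral_group_def)
next
  fix x :: "'a set \<times> ('a \<Rightarrow> 'a)"
  obtain Z \<pi> where x: "x = (Z, \<pi>)"
    by (metis surj_pair)
  show "\<one>\<^bsub>hyperoctahedral_group N\<^esub> \<otimes>\<^bsub>hyperoctahedral_group N\<^esub> x = x"
    unfolding x hyperoctahedral_group_def by simp
qed

lemma sign_patterns_square:
  "s \<in> sign_patterns N \<Longrightarrow> K \<subseteq> N \<Longrightarrow> s K * s K = 1"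
  unfolding sign_patterns_def by (drule PiE_mem[of _ _ _ K]) auto

lemma permute_permute:
  assumes "\<pi> permutes N"
  shows "permute N \<pi> (permute N \<sigma> s) = permute N (\<sigma> \<circ> \<pi>) s"
proof -
  have "\<pi> ` K \<subseteq> N" if "K \<subseteq> N" for K
    using that permutes_in_image[OF assms] by auto
  then show ?thesis
    by (auto simp: permute_def image_comp intro!: restrict_ext)
qed

lemma permute_swap:
  assumes "\<pi> permutes N" "W \<subseteq> N"
  shows "permute N \<pi> (swap N W s) = swap N (\<pi> -` W) (permute N \<pi> s)"
  unfolding permute_def swap_def
proof (rule restrict_ext)
  fix K assume "K \<in> Pow N"
  then have K: "K \<subseteq> N" by simp
  have inj: "inj \<pi>" and surj: "surj \<pi>"
    using assms(1) permutes_inj permutes_surj by blast+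
  have piK: "\<pi> ` K \<subseteq> N"
    using K permutes_in_image[OF assms(1)] by auto
  have W: "\<pi> -` W \<subseteq> N" by (rule permutes_vimage_subset[OF assms])
  have img: "\<pi> ` (\<pi> -` W) = W" by (rule surj_image_vimage_eq[OF surj])
  have "W \<inter> \<pi> ` K = \<pi> ` (\<pi> -` W \<inter> K)" by auto
  then have "card (W \<inter> \<pi> ` K) = card (\<pi> -` W \<inter> K)"
    using card_image[OF inj_on_subset[OF inj subset_UNIV]] by metis
  then have card: "card (\<pi> -` W \<inter> K) = card (W \<inter> \<pi> ` K)" by simp
  have sd: "\<pi> ` sym_diff (\<pi> -` W) K = sym_diff W (\<pi> ` K)"
    by (simp only: image_Un image_set_diff[OF inj] img)
  have sub: "sym_diff (\<pi> -` W) K \<subseteq> N" using W K by blast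
  show "(\<lambda>K\<in>Pow N. (-1) ^ card (W \<inter> K) * s W * s (sym_diff W K)) (\<pi> ` K) =
      (-1) ^ card (\<pi> -` W \<inter> K) * (\<lambda>K\<in>Pow N. s (\<pi> ` K)) (\<pi> -` W) *
        (\<lambda>K\<in>Pow N. s (\<pi> ` K)) (sym_diff (\<pi> -` W) K)"
    unfolding restrict_apply'[OF PowI[OF piK]] restrict_apply'[OF PowI[OF W]]
      restrict_apply'[OF PowI[OF sub]] card sd img ..
qed

lemma minus_one_power_card_sym_diff:
  assumes "finite A" "finite B"
  shows "(-1 :: int) ^ card (sym_diff A B) = (-1) ^ card A * (-1) ^ card B"
proof -
  have "card A = card (A - B) + card (A \<inter> B)" "card B = card (B - A) + card (A \<inter> B)"
    using card_Int_Diff[OF assms(1), of B] card_Int_Diff[OF assms(2), of A]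
    by (simp_all add: Int_commute)
  moreover have "card (sym_diff A B) = card (A - B) + card (B - A)"
    using assms by (intro card_Un_disjoint) auto
  moreover have "(-1 :: int) ^ n * (-1) ^ n = 1" for n
    by (simp flip: power_mult_distrib)
  ultimately show ?thesis
    by (simp add: power_add mult.assoc mult.left_commute)
qed

lemma swap_swap:
  assumes "finite N" "s \<in> sign_patterns N" "Z \<subseteq> N" "W \<subseteq> N"
  shows "swap N Z (swap N W s) = swap N (sym_diff Z W) s"
  unfolding swap_def
proof (rule restrict_ext)
  fix K assume "K \<in> Pow N"
  then have K: "K \<subseteq> N" by simp
  have fin: "finite (A \<inter> B)" if "A \<subseteq> N" for A B
    using assms(1) that finite_subset by blast
  have e1: "W \<inter> sym_diff Z K = sym_diff (W \<inter> Z) (W \<inter> K)"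
    and e2: "sym_diff Z W \<inter> K = sym_diff (Z \<inter> K) (W \<inter> K)"
    and e3: "sym_diff W (sym_diff Z K) = sym_diff (sym_diff Z W) K"
    and e4: "sym_diff W Z = sym_diff Z W"
    by auto
  have sub: "sym_diff Z K \<subseteq> N" using assms(3) K by auto
  have sq: "(-1 :: int) ^ n * (-1) ^ n = 1" for n
    by (simp flip: power_mult_distrib)
  have p1: "(-1::int) ^ card (W \<inter> sym_diff Z K) = (-1) ^ card (W \<inter> Z) * (-1) ^ card (W \<inter> K)"
    unfolding e1 by (intro minus_one_power_card_sym_diff fin assms)
  have p2: "(-1::int) ^ card (sym_diff Z W \<inter> K) = (-1) ^ card (Z \<inter> K) * (-1) ^ card (W \<inter> K)"
    unfolding e2 by (intro minus_one_power_card_sym_diff fin assms)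
  let ?a = "(-1::int) ^ card (Z \<inter> K)" and ?b = "(-1::int) ^ card (W \<inter> Z)"
    and ?c = "(-1::int) ^ card (W \<inter> K)" and ?t = "s (sym_diff Z W)"
    and ?u = "s (sym_diff (sym_diff Z W) K)"
  have "?a * (?b * s W * ?t) * (?b * ?c * s W * ?u)
      = (?b * ?b) * (s W * s W) * (?a * ?c * ?t * ?u)"
    by (simp only: mult_ac)
  also have "\<dots> = ?a * ?c * ?t * ?u"
    by (simp add: sq sign_patterns_square[OF assms(2,4)])
  finally show "(-1) ^ card (Z \<inter> K) *
      (\<lambda>K\<in>Pow N. (-1) ^ card (W \<inter> K) * s W * s (sym_diff W K)) Z *
      (\<lambda>K\<in>Pow N. (-1) ^ card (W \<inter> K) * s W * s (sym_diff W K)) (sym_diff Z K) =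
      (-1) ^ card (sym_diff Z W \<inter> K) * s (sym_diff Z W) * s (sym_diff (sym_diff Z W) K)"
    unfolding restrict_apply'[OF PowI[OF assms(3)]] restrict_apply'[OF PowI[OF sub]]
      p1 p2 e3 e4 .
qed

lemma permute_sign_patterns:
  assumes "\<pi> permutes N" "s \<in> sign_patterns N"
  shows "permute N \<pi> s \<in> sign_patterns N"
  unfolding permute_def sign_patterns_def
proof (rule restrict_PiE_iff[THEN iffD2], rule ballI)
  fix K assume "K \<in> Pow N"
  then have "\<pi> ` K \<in> Pow N"
    using permutes_in_image[OF assms(1)] by auto
  then show "s (\<pi> ` K) \<in> {1, -1}"
    by (rule PiE_mem[OF assms(2)[unfolded sign_patterns_def]])
qed

lemma hyperoctahedral_action_mult:
  assumes "finite N" "s \<in> sign_patterns N"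
    and "g \<in> carrier (hyperoctahedral_group N)" "h \<in> carrier (hyperoctahedral_group N)"
  shows "hyperoctahedral_action N (g \<otimes>\<^bsub>hyperoctahedral_group N\<^esub> h) s =
    hyperoctahedral_action N g (hyperoctahedral_action N h s)"
proof -
  obtain Z \<pi> W \<sigma> where gh: "g = (Z, \<pi>)" "h = (W, \<sigma>)"
    and *: "Z \<subseteq> N" "\<pi> permutes N" "W \<subseteq> N" "\<sigma> permutes N"
    using assms(3,4) by (auto simp: hyperoctahedral_group_def)
  have "hyperoctahedral_action N g (hyperoctahedral_action N h s) =
      swap N Z (swap N (\<pi> -` W) (permute N (\<sigma> \<circ> \<pi>) s))"
    by (simp add: gh hyperoctahedral_action_def permute_swap permute_permute *)
  also have "\<dots> = swap N (sym_diff Z (\<pi> -` W)) (permute N (\<sigma> \<circ> \<pi>) s)"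
    by (rule swap_swap[OF assms(1) permute_sign_patterns[OF permutes_compose[OF *(2,4)] assms(2)]
          *(1) permutes_vimage_subset[OF *(2,3)]])
  also have "\<dots> = hyperoctahedral_action N (g \<otimes>\<^bsub>hyperoctahedral_group N\<^esub> h) s"
    unfolding gh hyperoctahedral_action_def hyperoctahedral_group_def monoid.simps prod.case ..
  finally show ?thesis by (rule sym)
qed

(* The swap of the empty set multiplies s by s {}, so the identity acts trivially, and a pure
   permutation acts by permute, exactly under the normalisation s {} = 1. *)
lemma hyperoctahedral_action_permutation:
  assumes "s {} = 1"
  shows "hyperoctahedral_action N ({}, \<pi>) s = permute N \<pi> s"
  using assms by (auto simp: hyperoctahedral_action_def swap_def permute_def intro!: restrict_ext)

lemma hyperoctahedral_action_swap:
  assumes "s \<in> sign_patterns N"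
  shows "hyperoctahedral_action N (Z, id) s = swap N Z s"
proof -
  have "permute N id s = s"
    using assms unfolding permute_def sign_patterns_def image_id id_apply
    by (rule PiE_restrict)
  then show ?thesis
    by (simp add: hyperoctahedral_action_def)
qed

end

(* Admissibility says that s K = s (K Un {i, j}) implies s (K Un {i}) = s (K Un {j}). On a square
   K, K Un {i}, K Un {j}, K Un {i, j}, the swap of Z relabels the corners of another square of s.
   If i and j are both in Z or both outside Z, the two diagonals are preserved, and the signs on
   each diagonal change together. If exactly one of them is in Z, the diagonals are exchanged and
   exactly one sign on each is flipped, which turns the condition into its contrapositive. *)
theory Submission
  imports Defs
begin

text \<open>The corners of a square are written with \<open>insert\<close> and explicit
  non-membership, the form in which the simplifier evaluates cardinalities and images of the
  corners.\<close>

lemma admissibleI: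
  assumes "s \<in> sign_patterns N" "s {} = 1"
    and "\<And>i j K. \<lbrakk>i \<in> N; j \<in> N; i \<noteq> j; K \<subseteq> N; i \<notin> K; j \<notin> K;
      s (insert i K) \<noteq> s (insert j K)\<rbrakk> \<Longrightarrow> s K \<noteq> s (insert i (insert j K))"
  shows "admissible N s"
  unfolding admissible_def
proof (intro conjI ballI impI allI)
  fix i j K
  assume "i \<in> N" "j \<in> N" "i \<noteq> j" and K: "K \<subseteq> N - {i, j}"
    and "s (K \<union> {i}) \<noteq> s (K \<union> {j})"
  then have "s K \<noteq> s (insert i (insert j K))"
    by (intro assms(3)) auto
  moreover have "K \<union> {i, j} = insert i (insert j K)" by auto
  ultimately show "s K \<noteq> s (K \<union> {i, j})" by simp
qed (fact assms)+

lemma admissibleD: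
  assumes "admissible N s" "i \<in> N" "j \<in> N" "i \<noteq> j" "K \<subseteq> N" "i \<notin> K" "j \<notin> K"
    "s (insert i K) \<noteq> s (insert j K)"
  shows "s K \<noteq> s (insert i (insert j K))"
proof -
  have "K \<subseteq> N - {i, j}" using assms by blast
  then have "s (K \<union> {i}) \<noteq> s (K \<union> {j}) \<Longrightarrow> s K \<noteq> s (K \<union> {i, j})"
    using assms(1-4) unfolding admissible_def by blast
  moreover have "K \<union> {i, j} = insert i (insert j K)" by auto
  ultimately show ?thesis using assms(8) by simp
qed

lemma admissible_sign_patterns: "admissible N s \<Longrightarrow> s \<in> sign_patterns N"
  and admissible_empty: "admissible N s \<Longrightarrow> s {} = 1"
  by (simp_all add: admissible_def)

lemma sign_patterns_cases:
  assumes "s \<in> sign_patterns N" "K \<subseteq> N"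
  shows "s K = 1 \<or> s K = -1"
  using PiE_mem[OF assms(1)[unfolded sign_patterns_def] PowI[OF assms(2)]] by simp

lemma minus_one_power_cases: "(-1 :: int) ^ n = 1 \<or> (-1 :: int) ^ n = -1"
  by (cases "even n") auto

text \<open>The two middle corners have equal cardinality, and the cardinalities of the bottom and
  top corners differ by two, so on each diagonal both signs get the same factor and both comparisons
  are unchanged.\<close>

lemma admissible_negative:
  assumes "finite N" "admissible N s"
  shows "admissible N (negative N s)"
proof (rule admissibleI)
  show "negative N s \<in> sign_patterns N"
    unfolding sign_patterns_def negative_def
  proof (rule restrict_PiE_iff[THEN iffD2], rule ballI)
    fix K assume "K \<in> Pow N"
    then show "(-1) ^ card K * s K \<in> {1, -1}"
      using sign_patterns_cases[OF admissible_sign_patterns[OF assms(2)], of K]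
        minus_one_power_cases[of "card K"] by auto
  qed
  show "negative N s {} = 1"
    by (simp add: negative_def admissible_empty[OF assms(2)])
next
  fix i j K
  assume *: "i \<in> N" "j \<in> N" "i \<noteq> j" "K \<subseteq> N" "i \<notin> K" "j \<notin> K"
    and neq: "negative N s (insert i K) \<noteq> negative N s (insert j K)"
  have "finite K" using assms(1) *(4) by (rule rev_finite_subset)
  then have "s (insert i K) \<noteq> s (insert j K)"
    using neq * by (auto simp: negative_def)
  then have "s K \<noteq> s (insert i (insert j K))"
    by (rule admissibleD[OF assms(2) *])
  then show "negative N s K \<noteq> negative N s (insert i (insert j K))"
    using * \<open>finite K\<close> by (auto simp: negative_def)
qed

lemma admissible_permute:
  assumes "\<pi> permutes N" "admissible N s"
  shows "admissible N (permute N \<pi> s)"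
proof (rule admissibleI)
  show "permute N \<pi> s \<in> sign_patterns N"
    using assms by (intro permute_sign_patterns admissible_sign_patterns)
  show "permute N \<pi> s {} = 1"
    by (simp add: permute_def admissible_empty[OF assms(2)])
next
  fix i j K
  assume *: "i \<in> N" "j \<in> N" "i \<noteq> j" "K \<subseteq> N" "i \<notin> K" "j \<notin> K"
    and neq: "permute N \<pi> s (insert i K) \<noteq> permute N \<pi> s (insert j K)"
  have inj: "inj \<pi>" by (rule permutes_inj[OF assms(1)])
  have "s (insert (\<pi> i) (\<pi> ` K)) \<noteq> s (insert (\<pi> j) (\<pi> ` K))"
    using neq * by (simp add: permute_def)
  moreover have "\<pi> i \<in> N" "\<pi> j \<in> N" "\<pi> ` K \<subseteq> N"
    using *(1,2,4) permutes_in_image[OF assms(1)] by auto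
  moreover have "\<pi> i \<noteq> \<pi> j" "\<pi> i \<notin> \<pi> ` K" "\<pi> j \<notin> \<pi> ` K"
    using * by (simp_all add: inj_eq[OF inj] inj_image_mem_iff[OF inj])
  ultimately have "s (\<pi> ` K) \<noteq> s (insert (\<pi> i) (insert (\<pi> j) (\<pi> ` K)))"
    using admissibleD[OF assms(2)] by blast
  then show "permute N \<pi> s K \<noteq> permute N \<pi> s (insert i (insert j K))"
    using * by (simp add: permute_def)
qed

lemma admissible_swap:
  assumes "finite N" "Z \<subseteq> N" "admissible N s"
  shows "admissible N (swap N Z s)"
proof (rule admissibleI)
  note s = admissible_sign_patterns[OF assms(3)]
  show "swap N Z s \<in> sign_patterns N"
    unfolding sign_patterns_def swap_def
  proof (rule restrict_PiE_iff[THEN iffD2], rule ballI)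
    fix K assume "K \<in> Pow N"
    then have "sym_diff Z K \<subseteq> N" using assms(2) by blast
    from sign_patterns_cases[OF s this] sign_patterns_cases[OF s assms(2)]
    show "(-1) ^ card (Z \<inter> K) * s Z * s (sym_diff Z K) \<in> {1, -1}"
      using minus_one_power_cases[of "card (Z \<inter> K)"] by auto
  qed
  \<comment> \<open>The constant factor \<open>s Z\<close> in the swap turns the value at the empty
    set into \<open>s Z * s Z\<close>.\<close>
  show "swap N Z s {} = 1"
    using sign_patterns_square[OF s assms(2)] by (simp add: swap_def)
next
  fix i j K
  assume *: "i \<in> N" "j \<in> N" "i \<noteq> j" "K \<subseteq> N" "i \<notin> K" "j \<notin> K"
    and neq: "swap N Z s (insert i K) \<noteq> swap N Z s (insert j K)"
  note s = admissible_sign_patterns[OF assms(3)]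
  \<comment> \<open>The symmetric differences of \<open>Z\<close> with the four corners differ only
    in \<open>i\<close> and \<open>j\<close>; removing both elements leaves the bottom corner of the
    square of \<open>s\<close> that they form.\<close>
  define L where "L = sym_diff Z K - {i, j}"
  \<comment> \<open>The factor common to all four swapped values; being 1 or -1, it cancels in every
    comparison.\<close>
  define e where "e = (-1) ^ card (Z \<inter> K) * s Z"
  have L: "L \<subseteq> N" "i \<notin> L" "j \<notin> L"
    using assms(2) *(4) by (auto simp: L_def)
  have fin: "finite (Z \<inter> K)"
    using assms(1) *(4) by (blast intro: finite_subset)
  have e: "e = 1 \<or> e = -1"
    using minus_one_power_cases[of "card (Z \<inter> K)"] sign_patterns_cases[OF s assms(2)]
    by (auto simp: e_def)
  have vals: "s L = 1 \<or> s L = -1" "s (insert i L) = 1 \<or> s (insert i L) = -1"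
    "s (insert j L) = 1 \<or> s (insert j L) = -1"
    "s (insert i (insert j L)) = 1 \<or> s (insert i (insert j L)) = -1"
    using L(1) *(1,2) by (intro sign_patterns_cases[OF s]; simp)+
  have sq: "s (insert i L) \<noteq> s (insert j L) \<Longrightarrow> s L \<noteq> s (insert i (insert j L))"
    by (rule admissibleD[OF assms(3) *(1-3) L])
  \<comment> \<open>Inserting \<open>x\<close> into a set without \<open>x\<close> enlarges its
    intersection with \<open>Z\<close> exactly when \<open>x\<close> lies in
    \<open>Z\<close>.\<close>
  let ?sgn = "\<lambda>x. if x \<in> Z then -1 else 1 :: int"
  have swap: "swap N Z s K = e * s (sym_diff Z K)"
    "swap N Z s (insert i K) = ?sgn i * e * s (sym_diff Z (insert i K))"
    "swap N Z s (insert j K) = ?sgn j * e * s (sym_diff Z (insert j K))"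
    "swap N Z s (insert i (insert j K)) =
      ?sgn i * ?sgn j * e * s (sym_diff Z (insert i (insert j K)))"
    using * fin by (simp_all add: swap_def e_def)
  consider "i \<in> Z" "j \<in> Z" | "i \<in> Z" "j \<notin> Z" | "i \<notin> Z" "j \<in> Z" | "i \<notin> Z" "j \<notin> Z"
    by blast
  then show "swap N Z s K \<noteq> swap N Z s (insert i (insert j K))"
  proof cases
    case 1
    have "sym_diff Z K = insert i (insert j L)" "sym_diff Z (insert i K) = insert j L"
      "sym_diff Z (insert j K) = insert i L" "sym_diff Z (insert i (insert j K)) = L"
      using 1 * by (auto simp: L_def)
    \<comment> \<open>All values are 1 or -1, so a finite check over \<open>e\<close> and the four
      corners suffices.\<close>
    then show ?thesis using neq sq e vals 1 unfolding swap by (elim disjE; simp)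
  next
    \<comment> \<open>Here \<open>neq\<close> compares \<open>- e * s L\<close> with
      \<open>e\<close> times the top value, so it says that \<open>s\<close> agrees at bottom and
      top. By the contrapositive of \<open>sq\<close> it agrees at the middle corners, which the
      swap gives opposite factors.\<close>
    case 2
    have "sym_diff Z K = insert i L" "sym_diff Z (insert i K) = L"
      "sym_diff Z (insert j K) = insert i (insert j L)"
      "sym_diff Z (insert i (insert j K)) = insert j L"
      using 2 * by (auto simp: L_def)
    then show ?thesis using neq sq e vals 2 unfolding swap by (elim disjE; simp)
  next
    case 3
    have "sym_diff Z K = insert j L" "sym_diff Z (insert i K) = insert i (insert j L)"
      "sym_diff Z (insert j K) = L" "sym_diff Z (insert i (insert j K)) = insert i L"
      using 3 * by (auto simp: L_def)
    then show ?thesis using neq sq e vals 3 unfolding swap by (elim disjE; simp)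
  next
    case 4
    have "sym_diff Z K = L" "sym_diff Z (insert i K) = insert i L"
      "sym_diff Z (insert j K) = insert j L"
      "sym_diff Z (insert i (insert j K)) = insert i (insert j L)"
      using 4 * by (auto simp: L_def)
    then show ?thesis using neq sq e vals 4 unfolding swap by (elim disjE; simp)
  qed
qed

theorem lemma2p11:
  fixes N :: "'a set" and s :: "'a set \<Rightarrow> int"
  assumes "finite N"
    and "admissible N s"
  shows "admissible N (negative N s) \<and>
    (\<forall>g \<in> carrier (hyperoctahedral_group N). admissible N (hyperoctahedral_action N g s))"
  \<comment> \<open>A group element \<open>(Z, \<pi>)\<close> acts by \<open>permute\<close> first
    and then by \<open>swap\<close>, so the two closure lemmas are applied in succession.\<close>
  using assms
  by (auto simp: hyperoctahedral_group_def hyperoctahedral_action_def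
      intro: admissible_negative admissible_swap admissible_permute)

end
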